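(* Consider a $(K,F,r)$-computing matrix (of size $K\times F$) with a non-overlapping identity submatrix cover $\mathfrak{C}=\{C_1,\dots,C_S\}$ in which each identity submatrix has size $g\geq 2$. Let $\kappa$ be such that $K-\kappa\in\{0,1,\dots,g-2\}$. Then there exists a distributed computing scheme with $K$ nodes that is robust for $K-\kappa$ full stragglers, attaining computation load $r$ and communication load $L(\kappa)=\frac{2}{g}\left(\frac{K}{\kappa}-\frac{r}{\kappa}\right)$, with file complexity $F$.
   Context: Identity submatrices: an $l\times l$ submatrix $B$ of a binary ($0/1$) matrix $A$ is an identity submatrix of size $l$ if its columns are those of the $l\times l$ identity matrix in some order, i.e. $B$ is a permutation matrix. An entry $A(i,j)=1$ is covered by $B$ if $i$ is a row index and $j$ a column index of $B$. A set $\{C_1,\dots,C_S\}$ of identity submatrices of $A$ is an identity submatrix cover of $A$ if each non-zero entry of $A$ is covered by at least one $C_i$; it is non-overlapping if no non-zero entry is covered by two distinct members. Computing matrix: a binary matrix $C$ with rows indexed by a $K$-set $\mathcal{K}$ and columns by an $F$-set $\mathcal{F}$ such that each column has the same number $r$ of $0$'s is a $(K,F,r)$-computing matrix; it defines the assignment in which server $k$ maps subfile $f$ if $C(k,f)=0$ and does not map it if $C(k,f)=1$. Coded MapReduce model with full stragglers: there are $K$ servers (nodes) indexed by $\mathcal{K}$, and an input file divided into $F$ subfiles indexed by $\mathcal{F}$, $|\mathcal{F}|=F\geq K$; $F$ is the file complexity. There are $Q$ output functions. For $q\in[Q]$, $f\in\mathcal{F}$ there is an intermediate value (IVA) $v_{q,f}$,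 an arbitrary string of $T$ bits, computable from subfile $f$; the $q$-th output function is computed (reduced) from $\{v_{q,f}:f\in\mathcal{F}\}$. Each subfile is assigned to $r$ servers ($r$ is the computation load); $\mathcal{M}_k$ denotes the subfiles assigned to server $k$. Some set of $K-\kappa$ servers, the full stragglers, fail: they take no part in the map, shuffle or reduce phases. Each of the $\kappa$ surviving servers $k$ computes $v_{q,f}$ for all $q\in[Q]$, $f\in\mathcal{M}_k$. It is assumed that $Q/\kappa$ is an integer; the $Q$ functions are distributed evenly among the surviving servers, so that each surviving server $k$ must reduce a set $\mathcal{W}_k$ of $Q/\kappa$ functions. In the shuffle phase the surviving servers broadcast messages (each a function of the IVAs computed by the transmitting server) so that each surviving server $k$ can recover all $v_{q,f}$, $q\in\mathcal{W}_k$, $f\notin\mathcal{M}_k$, from the broadcasts and its own IVAs. The subfile assignment is fixed in advance, and a scheme is robust for $K-\kappa$ full stragglers if this works for every set of $K-\kappa$ failed servers. The communication load $L(\kappa)$ is $\frac{\text{number of bits transmitted in the shuffle phase}}{QFT}$ in the worst case over the sets of $K-\kappa$ stragglers. *)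

theory Defs
  imports Complex_Main "HOL-Library.FuncSet" "HOL-Library.Disjoint_Sets"
begin

text \<open>A matrix with rows indexed by \<open>\<K>\<close> and columns indexed by \<open>\<F>\<close> is a function
  \<open>'k \<Rightarrow> 'f \<Rightarrow> nat\<close> that is only inspected on \<open>\<K> \<times> \<F>\<close>.\<close>

definition computing_matrix ::
    "nat \<Rightarrow> nat \<Rightarrow> nat \<Rightarrow> 'k set \<Rightarrow> 'f set \<Rightarrow> ('k \<Rightarrow> 'f \<Rightarrow> nat) \<Rightarrow> bool" where
  "computing_matrix K F r \<K> \<F> C \<longleftrightarrow>
     finite \<K> \<and> card \<K> = K \<and> finite \<F> \<and> card \<F> = F \<and>
     (\<forall>k\<in>\<K>. \<forall>f\<in>\<F>. C k f \<in> {0, 1}) \<and>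
     (\<forall>f\<in>\<F>. card {k \<in> \<K>. C k f = 0} = r)"

definition assigned_subfiles :: "'f set \<Rightarrow> ('k \<Rightarrow> 'f \<Rightarrow> nat) \<Rightarrow> 'k \<Rightarrow> 'f set" where
  "assigned_subfiles \<F> C k = {f \<in> \<F>. C k f = 0}"

text \<open>A submatrix is given by its pair of row and column index sets. In
  \<open>identity_submatrix\<close>, column \<open>j\<close> is the column of the identity matrix (on the row set) whose
  \<open>1\<close> is in row \<open>\<sigma> j\<close>.\<close>

definition identity_submatrix ::
    "'k set \<Rightarrow> 'f set \<Rightarrow> ('k \<Rightarrow> 'f \<Rightarrow> nat) \<Rightarrow> nat \<Rightarrow> 'k set \<times> 'f set \<Rightarrow> bool" where
  "identity_submatrix \<K> \<F> A l B \<longleftrightarrow>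
     fst B \<subseteq> \<K> \<and> snd B \<subseteq> \<F> \<and> card (fst B) = l \<and> card (snd B) = l \<and>
     (\<exists>\<sigma>. bij_betw \<sigma> (snd B) (fst B) \<and>
          (\<forall>i\<in>fst B. \<forall>j\<in>snd B. A i j = (if i = \<sigma> j then 1 else 0)))"

definition covered_by :: "'k \<Rightarrow> 'f \<Rightarrow> 'k set \<times> 'f set \<Rightarrow> bool" where
  "covered_by i j B \<longleftrightarrow> i \<in> fst B \<and> j \<in> snd B"

definition identity_submatrix_cover ::
    "'k set \<Rightarrow> 'f set \<Rightarrow> ('k \<Rightarrow> 'f \<Rightarrow> nat) \<Rightarrow> ('k set \<times> 'f set) set \<Rightarrow> bool" where
  "identity_submatrix_cover \<K> \<F> A \<CC> \<longleftrightarrow>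
     (\<forall>B\<in>\<CC>. \<exists>l. identity_submatrix \<K> \<F> A l B) \<and>
     (\<forall>i\<in>\<K>. \<forall>j\<in>\<F>. A i j \<noteq> 0 \<longrightarrow> (\<exists>B\<in>\<CC>. covered_by i j B))"

definition non_overlapping ::
    "'k set \<Rightarrow> 'f set \<Rightarrow> ('k \<Rightarrow> 'f \<Rightarrow> nat) \<Rightarrow> ('k set \<times> 'f set) set \<Rightarrow> bool" where
  "non_overlapping \<K> \<F> A \<CC> \<longleftrightarrow>
     (\<forall>i\<in>\<K>. \<forall>j\<in>\<F>. A i j \<noteq> 0 \<longrightarrow>
        (\<forall>B\<in>\<CC>. \<forall>B'\<in>\<CC>. covered_by i j B \<and> covered_by i j B' \<longrightarrow> B = B'))"

text \<open>The intermediate value \<open>v\<^bsub>q,f\<^esub>\<close> is \<open>v (q, f)\<close>, a bit string of length \<open>T\<close>.\<close>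

type_synonym 'f ivas = "nat \<times> 'f \<Rightarrow> bool list"

definition all_ivas :: "nat \<Rightarrow> nat \<Rightarrow> 'f set \<Rightarrow> 'f ivas set" where
  "all_ivas Q T \<F> = ({1..Q} \<times> \<F>) \<rightarrow>\<^sub>E {b. length b = T}"

text \<open>The map assignment \<open>mapped\<close> is fixed in advance. The set of surviving servers is the first
  argument of the remaining components: it is only known after the stragglers have failed.
  The broadcasts of one server are concatenated into a single bit string; its length
  \<open>message_length\<close> does not depend on the data, so no information is carried by lengths.\<close>

record ('k, 'f) scheme =
  servers :: "'k set"
  files :: "'f set"
  mapped :: "'k \<Rightarrow> 'f set"
  reduced :: "'k set \<Rightarrow> 'k \<Rightarrow> nat set"
  message :: "'k set \<Rightarrow> 'k \<Rightarrow> 'f ivas \<Rightarrow> bool list"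
  message_length :: "'k set \<Rightarrow> 'k \<Rightarrow> nat"
  recover :: "'k set \<Rightarrow> 'k \<Rightarrow> ('k \<Rightarrow> bool list) \<Rightarrow> 'f ivas \<Rightarrow> 'f ivas"

definition survivor_sets :: "nat \<Rightarrow> ('k, 'f) scheme \<Rightarrow> 'k set set" where
  "survivor_sets \<kappa> \<S> = {servers \<S> - D | D. D \<subseteq> servers \<S> \<and> card D = card (servers \<S>) - \<kappa>}"

text \<open>Restriction makes messages and recovery depend only on what the server has access to.\<close>

definition own_ivas :: "nat \<Rightarrow> ('k, 'f) scheme \<Rightarrow> 'k \<Rightarrow> 'f ivas \<Rightarrow> 'f ivas" where
  "own_ivas Q \<S> k v = restrict v ({1..Q} \<times> mapped \<S> k)"

definition broadcasts :: "nat \<Rightarrow> ('k, 'f) scheme \<Rightarrow> 'k set \<Rightarrow> 'f ivas \<Rightarrow> 'k \<Rightarrow> bool list" where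
  "broadcasts Q \<S> U v = restrict (\<lambda>k. message \<S> U k (own_ivas Q \<S> k v)) U"

definition even_reduce_assignment :: "nat \<Rightarrow> nat \<Rightarrow> 'k set \<Rightarrow> ('k \<Rightarrow> nat set) \<Rightarrow> bool" where
  "even_reduce_assignment Q \<kappa> U W \<longleftrightarrow>
     (\<Union>k\<in>U. W k) = {1..Q} \<and> disjoint_family_on W U \<and> (\<forall>k\<in>U. card (W k) = Q div \<kappa>)"

definition valid_shuffle :: "nat \<Rightarrow> nat \<Rightarrow> ('k, 'f) scheme \<Rightarrow> 'k set \<Rightarrow> bool" where
  "valid_shuffle Q T \<S> U \<longleftrightarrow>
     (\<forall>v\<in>all_ivas Q T (files \<S>). \<forall>k\<in>U.
        length (message \<S> U k (own_ivas Q \<S> k v)) = message_length \<S> U k \<and>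
        (\<forall>q\<in>reduced \<S> U k. \<forall>f\<in>files \<S> - mapped \<S> k.
           recover \<S> U k (broadcasts Q \<S> U v) (own_ivas Q \<S> k v) (q, f) = v (q, f)))"

definition robust_scheme :: "nat \<Rightarrow> nat \<Rightarrow> nat \<Rightarrow> ('k, 'f) scheme \<Rightarrow> bool" where
  "robust_scheme Q T \<kappa> \<S> \<longleftrightarrow>
     finite (servers \<S>) \<and> finite (files \<S>) \<and> card (servers \<S>) \<le> card (files \<S>) \<and>
     (\<forall>k\<in>servers \<S>. mapped \<S> k \<subseteq> files \<S>) \<and>
     (\<forall>U\<in>survivor_sets \<kappa> \<S>.
        even_reduce_assignment Q \<kappa> U (reduced \<S> U) \<and> valid_shuffle Q T \<S> U)"

definition has_computation_load :: "('k, 'f) scheme \<Rightarrow> nat \<Rightarrow> bool" where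
  "has_computation_load \<S> r \<longleftrightarrow>
     (\<forall>f\<in>files \<S>. card {k \<in> servers \<S>. f \<in> mapped \<S> k} = r)"

definition file_complexity :: "('k, 'f) scheme \<Rightarrow> nat" where
  "file_complexity \<S> = card (files \<S>)"

definition communication_load :: "nat \<Rightarrow> nat \<Rightarrow> nat \<Rightarrow> ('k, 'f) scheme \<Rightarrow> real" where
  "communication_load Q T \<kappa> \<S> =
     Max ((\<lambda>U. real (\<Sum>k\<in>U. message_length \<S> U k) / real (Q * file_complexity \<S> * T))
            ` survivor_sets \<kappa> \<S>)"

end

theory Submission
  imports Defs
begin

text \<open>Fix the set \<open>U\<close> of survivors. As each identity submatrix \<open>B\<close> has \<open>g\<close> rows and at most \<open>g - 2\<close>
  servers fail, at least two rows \<open>p\<close>, \<open>p'\<close> of \<open>B\<close> survive. A row \<open>k\<close> of \<open>B\<close> lacks exactly one of the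
  subfiles of \<open>B\<close>, say \<open>c k\<close>. Server \<open>p\<close> broadcasts the XOR of the demands of all other surviving
  rows \<open>k\<close> for \<open>c k\<close>, from which each of these rows cancels all terms but its own; server \<open>p'\<close> then
  broadcasts the demand of \<open>p\<close> for \<open>c p\<close>. This costs \<open>2 (Q / \<kappa>) T\<close> bits per submatrix, and counting
  the non-zero entries in two ways gives \<open>g |\<CC>| = F (K - r)\<close>.\<close>

section \<open>Identity submatrices and the size of the cover\<close>

text \<open>Inverting the column-to-row bijection \<open>\<sigma>\<close> gives the row-wise form
  that the shuffle uses: \<open>c i\<close> is the one subfile of the submatrix that server
  \<open>i\<close> lacks.\<close>

lemma identity_submatrix_column:
  assumes "identity_submatrix \<K> \<F> A l B"
  obtains c where "bij_betw c (fst B) (snd B)"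
    and "\<And>i j. i \<in> fst B \<Longrightarrow> j \<in> snd B \<Longrightarrow> A i j = (if j = c i then 1 else 0)"
proof -
  obtain \<sigma> where \<sigma>: "bij_betw \<sigma> (snd B) (fst B)"
    and A: "\<forall>i\<in>fst B. \<forall>j\<in>snd B. A i j = (if i = \<sigma> j then 1 else 0)"
    using assms unfolding identity_submatrix_def by blast
  show thesis
  proof
    show "bij_betw (inv_into (snd B) \<sigma>) (fst B) (snd B)"
      using \<sigma> by (rule bij_betw_inv_into)
    show "A i j = (if j = inv_into (snd B) \<sigma> i then 1 else 0)" if "i \<in> fst B" "j \<in> snd B" for i j
      using A that bij_betw_inv_into_left[OF \<sigma>] bij_betw_inv_into_right[OF \<sigma>] by metis
  qed
qed

text \<open>The ones of the submatrix form the graph of the bijection \<open>c\<close>, one for each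
  row.\<close>

lemma identity_submatrix_card_ones:
  assumes "identity_submatrix \<K> \<F> A l B"
  shows "card {(i, j). i \<in> fst B \<and> j \<in> snd B \<and> A i j \<noteq> 0} = l"
proof -
  obtain c where c: "bij_betw c (fst B) (snd B)"
    and A: "\<And>i j. i \<in> fst B \<Longrightarrow> j \<in> snd B \<Longrightarrow> A i j = (if j = c i then 1 else 0)"
    by (rule identity_submatrix_column[OF assms]) blast
  have "{(i, j). i \<in> fst B \<and> j \<in> snd B \<and> A i j \<noteq> 0} = (\<lambda>i. (i, c i)) ` fst B"
    using A bij_betwE[OF c] by (auto split: if_splits)
  moreover have "inj_on (\<lambda>i. (i, c i)) (fst B)"
    by (auto simp: inj_on_def)
  ultimately show ?thesis
    using assms by (simp add: card_image identity_submatrix_def)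
qed

lemma finite_identity_submatrices:
  assumes "finite \<K>" and "finite \<F>" and "\<forall>B\<in>\<CC>. identity_submatrix \<K> \<F> A g B"
  shows "finite \<CC>"
proof -
  have "\<CC> \<subseteq> Pow \<K> \<times> Pow \<F>"
    using assms(3) by (intro subsetI) (simp add: mem_Times_iff identity_submatrix_def)
  then show ?thesis
    using assms(1,2) by (meson finite_Pow_iff finite_SigmaI finite_subset)
qed

text \<open>Double counting of the non-zero entries of \<open>C\<close>: the cover partitions them
  into groups of \<open>g\<close>, and each of the \<open>F\<close> columns contains
  \<open>K - r\<close> of them.\<close>

lemma cover_card:
  assumes cm: "computing_matrix K F r \<K> \<F> C"
    and cov: "identity_submatrix_cover \<K> \<F> C \<CC>"
    and non: "non_overlapping \<K> \<F> C \<CC>"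
    and id: "\<forall>B\<in>\<CC>. identity_submatrix \<K> \<F> C g B"
  shows "card \<CC> * g = F * (K - r)"
proof -
  have fin: "finite \<K>" "finite \<F>" and cards: "card \<K> = K" "card \<F> = F"
    using cm by (auto simp: computing_matrix_def)
  have sub: "fst B \<subseteq> \<K>" "snd B \<subseteq> \<F>" if "B \<in> \<CC>" for B
    using id that by (auto simp: identity_submatrix_def)
  let ?ones = "\<lambda>B. {(i, j). i \<in> fst B \<and> j \<in> snd B \<and> C i j \<noteq> 0}"
  have col: "card {k \<in> \<K>. C k f \<noteq> 0} = K - r" if "f \<in> \<F>" for f
  proof -
    have "{k \<in> \<K>. C k f \<noteq> 0} = \<K> - {k \<in> \<K>. C k f = 0}" by auto
    then show ?thesis
      using cm that fin by (simp add: computing_matrix_def card_Diff_subset)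
  qed
  have "card (?ones B) = g" if "B \<in> \<CC>" for B
    using id that by (blast intro: identity_submatrix_card_ones)
  then have "card \<CC> * g = (\<Sum>B\<in>\<CC>. card (?ones B))"
    by simp
  also have "\<dots> = card (\<Union>B\<in>\<CC>. ?ones B)"
  proof (rule card_UN_disjoint[symmetric])
    show "finite \<CC>"
      using finite_identity_submatrices[OF fin id] .
    show "\<forall>B\<in>\<CC>. finite (?ones B)"
    proof
      fix B assume "B \<in> \<CC>"
      then have "?ones B \<subseteq> \<K> \<times> \<F>" using sub[of B] by auto
      then show "finite (?ones B)" using fin by (meson finite_SigmaI finite_subset)
    qed
    show "\<forall>B\<in>\<CC>. \<forall>B'\<in>\<CC>. B \<noteq> B' \<longrightarrow> ?ones B \<inter> ?ones B' = {}"
    proof (intro ballI impI)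
      fix B B' assume "B \<in> \<CC>" "B' \<in> \<CC>" "B \<noteq> B'"
      then show "?ones B \<inter> ?ones B' = {}"
        using non sub[of B] unfolding non_overlapping_def covered_by_def by blast
    qed
  qed
  \<comment> \<open>Regroups the entries by columns, hence the swapped pairs: the number of ones is
    known per column only.\<close>
  also have "(\<Union>B\<in>\<CC>. ?ones B) = (\<lambda>(j, i). (i, j)) ` (SIGMA f:\<F>. {k \<in> \<K>. C k f \<noteq> 0})"
  proof (intro equalityI subsetI)
    fix x assume "x \<in> (\<Union>B\<in>\<CC>. ?ones B)"
    then show "x \<in> (\<lambda>(j, i). (i, j)) ` (SIGMA f:\<F>. {k \<in> \<K>. C k f \<noteq> 0})"
      using sub by (fastforce simp: image_iff)
  next
    fix x assume "x \<in> (\<lambda>(j, i). (i, j)) ` (SIGMA f:\<F>. {k \<in> \<K>. C k f \<noteq> 0})"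
    then show "x \<in> (\<Union>B\<in>\<CC>. ?ones B)"
      using cov unfolding identity_submatrix_cover_def covered_by_def by auto
  qed
  also have "card \<dots> = card (SIGMA f:\<F>. {k \<in> \<K>. C k f \<noteq> 0})"
    by (rule card_image) (auto simp: inj_on_def)
  also have "\<dots> = F * (K - r)"
    using fin col by (simp add: cards)
  finally show ?thesis .
qed

section \<open>Reduce assignments and survivor sets\<close>

text \<open>The functions are cut into \<open>\<kappa>\<close> consecutive blocks of equal size, one
  for each server of \<open>U\<close>.\<close>

lemma even_reduce_assignment_exists:
  assumes "finite U" and "card U = \<kappa>" and "\<kappa> dvd Q" and "Q \<ge> 1"
  shows "\<exists>W. even_reduce_assignment Q \<kappa> U W"
proof -
  obtain n where Q: "Q = \<kappa> * n"
    using assms(3) by blast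
  then have pos: "\<kappa> > 0" "n > 0"
    using assms(4) by (auto intro: Nat.gr0I)
  obtain e where e: "bij_betw e U {0..<\<kappa>}"
    using ex_bij_betw_finite_nat[OF assms(1)] assms(2) by auto
  \<comment> \<open>Functions are numbered from 1 and blocks from 0, hence \<open>q - 1\<close>.
    This form gives covering and disjointness; the interval form below gives the
    cardinality.\<close>
  define W where "W k = {q \<in> {1..Q}. (q - 1) div n = e k}" for k
  have block: "W k = {e k * n + 1..<e k * n + 1 + n}" if "k \<in> U" for k
  proof -
    have "e k < \<kappa>" using e that by (auto dest: bij_betwE)
    then have "e k * n + n \<le> Q"
      using mult_le_mono1[of "Suc (e k)" \<kappa> n] by (simp add: Q)
    moreover have "x div n = y \<longleftrightarrow> y * n \<le> x \<and> x < y * n + n" for x y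
    proof
      show "y * n \<le> x \<and> x < y * n + n" if "x div n = y"
        using div_times_less_eq_dividend[of x n] dividend_less_div_times[OF pos(2), of x]
        unfolding that by simp
      show "x div n = y" if "y * n \<le> x \<and> x < y * n + n"
        using that by (intro div_nat_eqI) (simp_all add: mult.commute)
    qed
    ultimately show ?thesis
      by (auto simp: W_def)
  qed
  have "(\<Union>k\<in>U. W k) = {1..Q}"
  proof (intro equalityI subsetI)
    fix q assume q: "q \<in> {1..Q}"
    then have "(q - 1) div n < \<kappa>"
      by (auto simp: Q less_mult_imp_div_less)
    then obtain k where "k \<in> U" "e k = (q - 1) div n"
      using e by (metis atLeastLessThan_iff bij_betw_def imageE zero_le)
    with q show "q \<in> (\<Union>k\<in>U. W k)" by (auto simp: W_def intro!: bexI[of _ k])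
  qed (auto simp: W_def)
  moreover have "disjoint_family_on W U"
    using e by (auto simp: disjoint_family_on_def W_def bij_betw_def inj_on_def)
  moreover have "\<forall>k\<in>U. card (W k) = Q div \<kappa>"
    using pos by (simp add: block Q)
  ultimately show ?thesis
    unfolding even_reduce_assignment_def by blast
qed

lemma survivor_setsE:
  assumes "U \<in> survivor_sets \<kappa> \<S>" and "finite (servers \<S>)" and "\<kappa> \<le> card (servers \<S>)"
  shows "U \<subseteq> servers \<S>" and "card U = \<kappa>"
    and "card (servers \<S> - U) = card (servers \<S>) - \<kappa>"
proof -
  obtain D where D: "U = servers \<S> - D" "D \<subseteq> servers \<S>" "card D = card (servers \<S>) - \<kappa>"
    using assms(1) by (auto simp: survivor_sets_def)
  show "U \<subseteq> servers \<S>" using D by auto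
  show "card U = \<kappa>"
    using D assms(2,3) by (simp add: card_Diff_subset finite_subset)
  show "card (servers \<S> - U) = card (servers \<S>) - \<kappa>"
    using D by (simp add: double_diff)
qed

text \<open>Truncated subtraction never exceeds the number of servers, so a straggler set of the
  required size exists. Thus the \<open>Max\<close> in the communication load is taken over a
  nonempty set.\<close>

lemma survivor_sets_nonempty:
  "survivor_sets \<kappa> \<S> \<noteq> {}"
proof -
  obtain D where "D \<subseteq> servers \<S>" "card D = card (servers \<S>) - \<kappa>"
    by (meson diff_le_self obtain_subset_with_card_n)
  then show ?thesis by (auto simp: survivor_sets_def)
qed

section \<open>The coded shuffle for a fixed set of survivors\<close>

text \<open>XOR cancellation, with the XOR of bits written as the parity of the number of ones.\<close>

lemma odd_card_cancel:
  assumes "finite A" and "a \<in> A" and "\<And>x. x \<in> A \<Longrightarrow> x \<noteq> a \<Longrightarrow> P x \<longleftrightarrow> P' x"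
    and "odd (card {x \<in> A. P x}) \<longleftrightarrow> odd (card {x \<in> A. P' x})"
  shows "P a \<longleftrightarrow> P' a"
proof -
  \<comment> \<open>Isolates the contribution of \<open>a\<close>; the remaining counts for
    \<open>P\<close> and \<open>P'\<close> agree, so equal parities force equality at
    \<open>a\<close>.\<close>
  have split: "card {x \<in> A. R x} = card {x \<in> A - {a}. R x} + of_bool (R a)" for R
  proof (cases "R a")
    case True
    then have "{x \<in> A. R x} = insert a {x \<in> A - {a}. R x}"
      using assms(2) by auto
    with True assms(1) show ?thesis by simp
  next
    case False
    then have "{x \<in> A. R x} = {x \<in> A - {a}. R x}" by auto
    with False show ?thesis by simp
  qed
  have "{x \<in> A - {a}. P x} = {x \<in> A - {a}. P' x}"
    using assms(3) by auto
  then show ?thesis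
    using assms(4) split[of P] split[of P'] by (auto split: if_splits)
qed

text \<open>A transmitted bit is labelled \<open>(B, b, m, t)\<close>: it belongs to the broadcast of the first or
  second sender of \<open>B\<close>, according to \<open>b\<close>, and is bit \<open>t\<close> of the block of the \<open>m\<close>-th demanded function.
  Decodability is stated as injectivity; no explicit decoder is needed, since \<open>recover\<close> may be
  any function of the received data.\<close>

lemma coded_shuffle_exists:
  fixes C :: "'k \<Rightarrow> 'f \<Rightarrow> nat"
  assumes "finite \<K>" and "finite \<F>" and "U \<subseteq> \<K>"
    and cov: "identity_submatrix_cover \<K> \<F> C \<CC>"
    and id: "\<forall>B\<in>\<CC>. identity_submatrix \<K> \<F> C g B"
    and two: "\<And>B. B \<in> \<CC> \<Longrightarrow> \<exists>p\<in>fst B \<inter> U. \<exists>p'\<in>fst B \<inter> U. p \<noteq> p'"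
    and W: "even_reduce_assignment Q \<kappa> U W"
  defines "own \<equiv> \<lambda>k (v :: 'f ivas). restrict v ({1..Q} \<times> assigned_subfiles \<F> C k)"
  shows "\<exists>(msg :: 'k \<Rightarrow> 'f ivas \<Rightarrow> bool list) len. (\<forall>k v. length (msg k v) = len k) \<and>
    (\<Sum>k\<in>U. len k) = 2 * card \<CC> * (Q div \<kappa>) * T \<and>
    (\<forall>v\<in>all_ivas Q T \<F>. \<forall>v'\<in>all_ivas Q T \<F>. \<forall>k\<in>U.
       (\<forall>l\<in>U. msg l (own l v) = msg l (own l v')) \<longrightarrow> own k v = own k v' \<longrightarrow>
       (\<forall>q\<in>W k. \<forall>f\<in>\<F> - assigned_subfiles \<F> C k. v (q, f) = v' (q, f)))"
proof -
  let ?n = "Q div \<kappa>"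
  have finU: "finite U" and fin\<CC>: "finite \<CC>"
    using assms(1-3) finite_identity_submatrices[OF _ _ id] finite_subset by auto
  have Wk: "W k \<subseteq> {1..Q}" "card (W k) = ?n" if "k \<in> U" for k
    using W that by (auto simp: even_reduce_assignment_def)
  \<comment> \<open>All demand sets are enumerated over the same range, so that the
    \<open>m\<close>-th demands of different servers can be combined.\<close>
  have "\<exists>w. bij_betw w {0..<?n} (W k)" if "k \<in> U" for k
    using ex_bij_betw_nat_finite[of "W k"] Wk[OF that] finite_subset by (metis finite_atLeastAtMost)
  then obtain w where w: "\<And>k. k \<in> U \<Longrightarrow> bij_betw (w k) {0..<?n} (W k)"
    by metis
  have wQ: "w k m \<in> {1..Q}" if "k \<in> U" "m < ?n" for k m
    using bij_betwE[OF w[OF that(1)]] Wk(1)[OF that(1)] that(2) by fastforce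
  obtain p p' where p: "\<And>B. B \<in> \<CC> \<Longrightarrow> p B \<in> fst B \<inter> U \<and> p' B \<in> fst B \<inter> U \<and> p B \<noteq> p' B"
    using two by metis
  have "\<exists>c. bij_betw c (fst B) (snd B) \<and>
      (\<forall>i\<in>fst B. \<forall>j\<in>snd B. C i j = (if j = c i then 1 else 0))" if "B \<in> \<CC>" for B
    using identity_submatrix_column[of \<K> \<F> C g B] id that by metis
  then obtain c where c: "\<And>B. B \<in> \<CC> \<Longrightarrow> bij_betw (c B) (fst B) (snd B)"
    and Cc: "\<And>B i j. B \<in> \<CC> \<Longrightarrow> i \<in> fst B \<Longrightarrow> j \<in> snd B \<Longrightarrow> C i j = (if j = c B i then 1 else 0)"
    by metis
  \<comment> \<open>In row \<open>k\<close> of \<open>B\<close> every column except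
    \<open>c B k\<close> has a \<open>0\<close>. So server \<open>k\<close> has mapped the subfile
    demanded by any other row \<open>l\<close>; senders need this for encoding and receivers for
    cancelling.\<close>
  have known: "own k v (w l m, c B l) = v (w l m, c B l)"
    if "B \<in> \<CC>" "k \<in> fst B" "l \<in> fst B \<inter> U" "k \<noteq> l" "m < ?n" for B k l m v
  proof -
    have cl: "c B l \<in> snd B" "c B l \<noteq> c B k"
      using c[OF that(1)] that by (auto simp: bij_betw_def inj_on_def)
    moreover have "snd B \<subseteq> \<F>"
      using id that(1) by (auto simp: identity_submatrix_def)
    ultimately have "c B l \<in> assigned_subfiles \<F> C k"
      using Cc[OF that(1,2) cl(1)] by (auto simp: assigned_subfiles_def)
    then show ?thesis
      using wQ[of l m] that by (auto simp: own_def)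
  qed
  define R where "R B = fst B \<inter> U - {p B}" for B
  define I where "I = \<CC> \<times> (UNIV :: bool set) \<times> {..<?n} \<times> {..<T}"
  define sender where "sender = (\<lambda>(B, b, m :: nat, t :: nat). if b then p' B else p B)"
  define val where "val v = (\<lambda>(B, b, m, t).
      if b then v (w (p B) m, c B (p B)) ! t
      else odd (card {k \<in> R B. v (w k m, c B k) ! t}))" for v :: "'f ivas"
  have finI: "finite I"
    using fin\<CC> by (simp add: I_def)
  \<comment> \<open>A sender can compute its bits from its own IVAs: \<open>p B\<close> is excluded
    from \<open>R B\<close>, and \<open>p' B\<close> differs from \<open>p B\<close>.\<close>
  have val_own: "val (own (sender i) v) i = val v i" if "i \<in> I" for i v
  proof -
    obtain B b m t where i: "i = (B, b, m, t)" by (cases i)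
    with that have B: "B \<in> \<CC>" and m: "m < ?n" by (auto simp: I_def)
    show ?thesis
    proof (cases b)
      case True
      then show ?thesis
        using known[OF B, of "p' B" "p B" m] p[OF B] m by (auto simp: i val_def sender_def)
    next
      case False
      have "own (p B) v (w k m, c B k) = v (w k m, c B k)" if "k \<in> R B" for k
        using known[OF B, of "p B" k m] p[OF B] m that by (auto simp: R_def)
      then have "{k \<in> R B. own (p B) v (w k m, c B k) ! t} = {k \<in> R B. v (w k m, c B k) ! t}"
        by auto
      with False show ?thesis
        by (simp add: i val_def sender_def)
    qed
  qed
  \<comment> \<open>The order of the labels is fixed independently of \<open>v\<close>, so message
    lengths do not depend on the data.\<close>
  have "\<exists>xs. set xs = {i \<in> I. sender i = k} \<and> distinct xs" for k
    using finI by (intro finite_distinct_list) auto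
  then obtain xs where xs: "\<And>k. set (xs k) = {i \<in> I. sender i = k}" "\<And>k. distinct (xs k)"
    by metis
  define msg where "msg k v = map (val v) (xs k)" for k v
  \<comment> \<open>Each label has exactly one sender, and that sender survives, so the sum counts
    every label once. The factor 2 is the size of \<open>bool\<close>.\<close>
  have "(\<Sum>k\<in>U. length (xs k)) = (\<Sum>k\<in>U. \<Sum>i | i \<in> I \<and> sender i = k. 1)"
    using xs by (metis card_eq_sum distinct_card)
  also have "\<dots> = (\<Sum>i\<in>I. 1)"
    by (rule sum.group[OF finI finU]) (use p in \<open>auto simp: I_def sender_def\<close>)
  also have "\<dots> = 2 * card \<CC> * ?n * T"
    by (simp add: I_def card_cartesian_product)
  finally have total: "(\<Sum>k\<in>U. length (xs k)) = 2 * card \<CC> * ?n * T" .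
  have "v (q, f) = v' (q, f)"
    if v: "v \<in> all_ivas Q T \<F>" and v': "v' \<in> all_ivas Q T \<F>" and k: "k \<in> U"
      and eq: "\<forall>l\<in>U. msg l (own l v) = msg l (own l v')" and own: "own k v = own k v'"
      and q: "q \<in> W k" and f: "f \<in> \<F> - assigned_subfiles \<F> C k" for v v' k q f
  proof -
    \<comment> \<open>Equal broadcasts determine every transmitted bit, since all senders lie in
      \<open>U\<close>.\<close>
    have val: "val v i = val v' i" if "i \<in> I" for i
    proof -
      have "sender i \<in> U"
        using that p by (auto simp: I_def sender_def)
      then have "val (own (sender i) v) i = val (own (sender i) v') i"
        using eq xs(1)[of "sender i"] that by (auto simp: msg_def)
      then show ?thesis
        using val_own[OF that] by simp
    qed
    have "C k f \<noteq> 0"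
      using f by (auto simp: assigned_subfiles_def)
    then obtain B where B: "B \<in> \<CC>" and kB: "k \<in> fst B" and fB: "f \<in> snd B"
      using cov k f assms(3) unfolding identity_submatrix_cover_def covered_by_def by blast
    have fc: "f = c B k"
      using Cc[OF B kB fB] \<open>C k f \<noteq> 0\<close> by (simp split: if_splits)
    have "q \<in> w k ` {0..<?n}"
      using w[OF k] q by (simp add: bij_betw_def)
    then obtain m where m: "m < ?n" and qm: "q = w k m"
      by auto
    \<comment> \<open>The interfering terms are among the IVAs that server \<open>k\<close> has
      computed itself.\<close>
    have same: "v (w l m, c B l) = v' (w l m, c B l)" if "l \<in> fst B \<inter> U" "l \<noteq> k" for l
      using known[OF B kB that(1) _ m, of v] known[OF B kB that(1) _ m, of v'] own that(2) by metis
    have len: "length (u (q, f)) = T" if "u \<in> all_ivas Q T \<F>" for u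
      using that q f Wk(1)[OF k] by (auto simp: all_ivas_def PiE_iff)
    show ?thesis
    proof (rule nth_equalityI)
      show "length (v (q, f)) = length (v' (q, f))"
        using len v v' by simp
      fix t assume "t < length (v (q, f))"
      then have t: "t < T" using len v by simp
      show "v (q, f) ! t = v' (q, f) ! t"
      \<comment> \<open>The first sender gets its demand uncoded from the second one; any other
        surviving row cancels the known terms of the XOR.\<close>
      proof (cases "k = p B")
        case True
        then show ?thesis
          using val[of "(B, True, m, t)"] B m t by (simp add: I_def val_def qm fc)
      next
        case False
        have "(v (w k m, c B k) ! t) = (v' (w k m, c B k) ! t)"
        proof (rule odd_card_cancel[where A = "R B"])
          show "finite (R B)" using finU by (simp add: R_def)
          show "k \<in> R B" using False k kB by (simp add: R_def)
          show "odd (card {x \<in> R B. v (w x m, c B x) ! t}) \<longleftrightarrow>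
              odd (card {x \<in> R B. v' (w x m, c B x) ! t})"
            using val[of "(B, False, m, t)"] B m t by (simp add: I_def val_def)
        qed (use same in \<open>auto simp: R_def\<close>)
        then show ?thesis by (simp add: qm fc)
      qed
    qed
  qed
  then show ?thesis
    using total by (intro exI[of _ msg] exI[of _ "\<lambda>k. length (xs k)"]) (auto simp: msg_def)
qed

section \<open>Assembly of the scheme and its communication load\<close>

theorem theorem8:
  fixes C :: "'k \<Rightarrow> 'f \<Rightarrow> nat" and \<K> :: "'k set" and \<F> :: "'f set"
    and \<CC> :: "('k set \<times> 'f set) set" and K F r g \<kappa> Q T :: nat
  assumes "computing_matrix K F r \<K> \<F> C"
    and "K \<le> F"
    and "identity_submatrix_cover \<K> \<F> C \<CC>"
    and "non_overlapping \<K> \<F> C \<CC>"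
    and "\<forall>B\<in>\<CC>. identity_submatrix \<K> \<F> C g B"
    and "g \<ge> 2"
    and "\<kappa> \<le> K" and "K - \<kappa> \<in> {0..g - 2}"
    and "Q \<ge> 1" and "T \<ge> 1" and "\<kappa> dvd Q"
  shows "\<exists>\<S> :: ('k, 'f) scheme.
    servers \<S> = \<K> \<and> card (servers \<S>) = K \<and> files \<S> = \<F> \<and>
    (\<forall>k\<in>\<K>. mapped \<S> k = assigned_subfiles \<F> C k) \<and>
    robust_scheme Q T \<kappa> \<S> \<and>
    has_computation_load \<S> r \<and>
    communication_load Q T \<kappa> \<S> = 2 / real g * (real K / real \<kappa> - real r / real \<kappa>) \<and>
    file_complexity \<S> = F"
proof -
  have fin: "finite \<K>" "finite \<F>" and cards: "card \<K> = K" "card \<F> = F"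
    using assms(1) by (auto simp: computing_matrix_def)
  have pos: "\<kappa> > 0" "F > 0"
    using assms(2,7,9,11) by (auto intro!: Nat.gr0I)
  let ?M = "assigned_subfiles \<F> C"
  define own where "own = (\<lambda>k (v :: 'f ivas). restrict v ({1..Q} \<times> ?M k))"
  \<comment> \<open>The survivor sets are needed before the scheme exists, since its components are
    chosen for each of them. They depend on the servers alone, so a record with
    \<open>undefined\<close> entries serves to derive their properties.\<close>
  define \<U> where "\<U> = {\<K> - D | D. D \<subseteq> \<K> \<and> card D = card \<K> - \<kappa>}"
  have U: "U \<subseteq> \<K>" "card U = \<kappa>" "card (\<K> - U) = K - \<kappa>" if "U \<in> \<U>" for U
    using survivor_setsE[of U \<kappa> "\<lparr>servers = \<K>, files = \<F>, mapped = ?M, reduced = undefined,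
        message = undefined, message_length = undefined, recover = undefined\<rparr>"] that fin cards assms(7)
    by (auto simp: survivor_sets_def \<U>_def)
  have two: "\<exists>p\<in>fst B \<inter> U. \<exists>p'\<in>fst B \<inter> U. p \<noteq> p'" if "U \<in> \<U>" "B \<in> \<CC>" for U B
  proof -
    have B: "fst B \<subseteq> \<K>" "card (fst B) = g"
      using assms(5) that(2) by (auto simp: identity_submatrix_def)
    \<comment> \<open>Rows of \<open>B\<close> either survive or are among the at most
      \<open>g - 2\<close> failed servers.\<close>
    have "g \<le> card (fst B \<inter> U \<union> (\<K> - U))"
      unfolding B(2)[symmetric] using B fin by (intro card_mono) (auto intro: finite_subset)
    also have "\<dots> \<le> card (fst B \<inter> U) + (K - \<kappa>)"
      using card_Un_le[of "fst B \<inter> U" "\<K> - U"] U(3)[OF that(1)] by simp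
    finally have "\<not> card (fst B \<inter> U) \<le> Suc 0"
      using assms(6,8) by auto
    moreover have "finite (fst B \<inter> U)"
      using B(1) fin(1) finite_subset by auto
    ultimately show ?thesis
      using card_le_Suc0_iff_eq by blast
  qed
  have "\<exists>W. even_reduce_assignment Q \<kappa> U W" if "U \<in> \<U>" for U
    using even_reduce_assignment_exists U[OF that] fin(1) finite_subset assms(9,11) by metis
  then obtain W where W: "\<And>U. U \<in> \<U> \<Longrightarrow> even_reduce_assignment Q \<kappa> U (W U)"
    by metis
  define good where "good U msg len \<longleftrightarrow> (\<forall>k v. length (msg k v) = len k) \<and>
    (\<Sum>k\<in>U. len k) = 2 * card \<CC> * (Q div \<kappa>) * T \<and>
    (\<forall>v\<in>all_ivas Q T \<F>. \<forall>v'\<in>all_ivas Q T \<F>. \<forall>k\<in>U.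
       (\<forall>l\<in>U. msg l (own l v) = msg l (own l v')) \<longrightarrow> own k v = own k v' \<longrightarrow>
       (\<forall>q\<in>W U k. \<forall>f\<in>\<F> - ?M k. v (q, f) = v' (q, f)))"
    for U and msg :: "'k \<Rightarrow> 'f ivas \<Rightarrow> bool list" and len
  have "\<exists>msg len. good U msg len" if "U \<in> \<U>" for U
    unfolding good_def own_def
    using coded_shuffle_exists[OF fin U(1)[OF that] assms(3,5) two[OF that] W[OF that]] .
  then obtain msg len where good: "\<And>U. U \<in> \<U> \<Longrightarrow> good U (msg U) (len U)"
    by metis
  have len: "length (msg U k v) = len U k"
    and total: "(\<Sum>k\<in>U. len U k) = 2 * card \<CC> * (Q div \<kappa>) * T" if "U \<in> \<U>" for U k v
    using good[OF that] by (auto simp: good_def)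
  have dec: "v (q, f) = v' (q, f)"
    if "U \<in> \<U>" "v \<in> all_ivas Q T \<F>" "v' \<in> all_ivas Q T \<F>" "k \<in> U"
      "\<forall>l\<in>U. msg U l (own l v) = msg U l (own l v')" "own k v = own k v'"
      "q \<in> W U k" "f \<in> \<F> - ?M k" for U v v' k q f
    using good[OF that(1)] that(2-) unfolding good_def by blast
  define bc where "bc = (\<lambda>U v. restrict (\<lambda>k. msg U k (own k v)) U)"
  have bcD: "msg U l (own l v) = msg U l (own l v')" if "bc U v = bc U v'" "l \<in> U" for U l v v'
    using fun_cong[OF that(1), of l] that(2) by (simp add: bc_def)
  \<comment> \<open>The decoder picks any IVA family consistent with the received data. The true one
    is such a family, and by \<open>dec\<close> all of them agree on the demanded values.\<close>
  define rec where "rec U k b o' =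
    (SOME v. v \<in> all_ivas Q T \<F> \<and> bc U v = b \<and> own k v = o')" for U k b o'
  define \<S> where "\<S> = \<lparr>servers = \<K>, files = \<F>, mapped = ?M, reduced = W,
    message = msg, message_length = len, recover = rec\<rparr>"
  have surv: "survivor_sets \<kappa> \<S> = \<U>"
    by (simp add: survivor_sets_def \<S>_def \<U>_def)
  have own: "own_ivas Q \<S> k v = own k v" for k v
    by (simp add: own_ivas_def own_def \<S>_def)
  have bc: "broadcasts Q \<S> U v = bc U v" for U v
    unfolding broadcasts_def bc_def own by (simp add: \<S>_def)
  have rec: "rec U k (bc U v) (own k v) (q, f) = v (q, f)"
    if "U \<in> \<U>" "v \<in> all_ivas Q T \<F>" "k \<in> U" "q \<in> W U k" "f \<in> \<F> - ?M k" for U k v q f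
  proof -
    let ?v = "rec U k (bc U v) (own k v)"
    have v: "?v \<in> all_ivas Q T \<F> \<and> bc U ?v = bc U v \<and> own k ?v = own k v"
      unfolding rec_def by (rule someI[of _ v]) (use that(2) in simp)
    then have "\<forall>l\<in>U. msg U l (own l ?v) = msg U l (own l v)"
      using bcD by blast
    then show ?thesis
      using dec[OF that(1) _ that(2,3) _ _ that(4,5)] v by blast
  qed
  have "robust_scheme Q T \<kappa> \<S>"
    unfolding robust_scheme_def surv valid_shuffle_def own bc
    using fin cards assms(2) W len rec by (auto simp: \<S>_def assigned_subfiles_def)
  moreover have "has_computation_load \<S> r"
    using assms(1) by (simp add: has_computation_load_def \<S>_def assigned_subfiles_def computing_matrix_def)
  moreover have "communication_load Q T \<kappa> \<S> = 2 / real g * (real K / real \<kappa> - real r / real \<kappa>)"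
  proof -
    \<comment> \<open>An actual column is needed to bound \<open>r\<close> by \<open>K\<close>,
      which turns the truncated \<open>K - r\<close> into a real difference.\<close>
    have "\<F> \<noteq> {}" using pos cards by auto
    then obtain f where "f \<in> \<F>" by blast
    then have "r = card {k \<in> \<K>. C k f = 0}"
      using assms(1) by (simp add: computing_matrix_def)
    then have "r \<le> K"
      using fin cards by (metis (no_types, lifting) card_mono mem_Collect_eq subsetI)
    have count: "real (card \<CC>) * real g = real F * (real K - real r)"
      using arg_cong[OF cover_card[OF assms(1,3,4,5)], of real] \<open>r \<le> K\<close> by (simp add: of_nat_diff)
    \<comment> \<open>The load is the same for all survivor sets, so the worst case is the maximum
      of a singleton.\<close>
    have "(\<lambda>U. real (\<Sum>k\<in>U. message_length \<S> U k) / real (Q * file_complexity \<S> * T)) ` \<U>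
        = {real (2 * card \<CC> * (Q div \<kappa>) * T) / real (Q * F * T)}"
    proof -
      have "\<U> \<noteq> {}" using survivor_sets_nonempty[of \<kappa> \<S>] surv by simp
      moreover have "real (\<Sum>k\<in>U. message_length \<S> U k) / real (Q * file_complexity \<S> * T)
          = real (2 * card \<CC> * (Q div \<kappa>) * T) / real (Q * F * T)" if "U \<in> \<U>" for U
        using total[OF that] cards by (simp add: \<S>_def file_complexity_def)
      ultimately show ?thesis by force
    qed
    then have "communication_load Q T \<kappa> \<S> = real (2 * card \<CC> * (Q div \<kappa>) * T) / real (Q * F * T)"
      unfolding communication_load_def surv by simp
    also have "\<dots> = 2 * real (card \<CC>) / (real \<kappa> * real F)"
    proof -
      have "real (Q div \<kappa>) = real Q / real \<kappa>"
        using assms(11) by (rule real_of_nat_div)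
      then show ?thesis
        using assms(9,10) by (simp add: field_simps)
    qed
    also have "real (card \<CC>) = real F * (real K - real r) / real g"
      using count assms(6) by (simp add: field_simps)
    also have "2 * (real F * (real K - real r) / real g) / (real \<kappa> * real F)
        = 2 / real g * (real K / real \<kappa> - real r / real \<kappa>)"
      using pos assms(6) by (simp add: field_simps)
    finally show ?thesis .
  qed
  ultimately show ?thesis
    using cards by (intro exI[of _ \<S>]) (simp add: \<S>_def file_complexity_def)
qed

end
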